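(* Let $r,s,n$ be positive integers, and let $b_{r,s}(n)$ be the number of permutations $\pi$ of $\{1,\dots,n\}$ such that $|\pi_{i+r}-\pi_i|\neq s$ for all $1\le i\le n-r$. Then $$b_{r,s}(n)=\sum_{\alpha} C^{(n,s)}_{\alpha}\cdot C^{(n,r)}_{\alpha}\cdot(-1)^{a_1+a_2+\cdots+a_n-n}\,a_1!\,a_2!\cdots a_n!\cdot 2^{a_2+a_3+\cdots+a_n},$$ where the sum ranges over all integer partitions $\alpha=1^{a_1}2^{a_2}\cdots n^{a_n}$ of $n$ written in frequency notation (so $1\cdot a_1+2\cdot a_2+\cdots+n\cdot a_n=n$), and $C^{(n,r)}_\alpha$, $C^{(n,s)}_\alpha$ are the tiling coefficients defined in the context.
   Context: A permutation $\pi$ of $\{1,\dots,n\}$ is written $\pi_1\pi_2\cdots\pi_n$. For a positive integer $r$, an $r$-tile is any translate (horizontal shift) of one of the sets $\{1\}$, $\{1,1+r\}$, $\{1,1+r,1+2r\}$, $\{1,1+r,1+2r,1+3r\}$, $\dots$, i.e. a set $\{m,m+r,\dots,m+(k-1)r\}$ with $k\ge 1$. An $r$-tiling of $\{1,\dots,n\}$ is a set partition of $\{1,\dots,n\}$ all of whose blocks are $r$-tiles. The weight of a tile $t$ is the variable $x_{\#t}$, the weight of a tiling is the product of the weights of its tiles, and $$f_{r,n}(x_1,\dots,x_n)=\sum_{T}\mathrm{weight}(T)=\sum_{\alpha}C^{(n,r)}_{\alpha}\,x_1^{a_1}x_2^{a_2}\cdots x_n^{a_n},$$ where $T$ ranges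 over all $r$-tilings of $\{1,\dots,n\}$ and $\alpha=1^{a_1}2^{a_2}\cdots n^{a_n}$ ranges over all integer partitions of $n$. Thus $C^{(n,r)}_\alpha$ is the number of $r$-tilings of $\{1,\dots,n\}$ having exactly $a_i$ tiles of size $i$ for each $i$; $C^{(n,s)}_\alpha$ is defined in the same way with $s$ in place of $r$. *)

theory Defs
  imports Complex_Main "HOL-Library.Disjoint_Sets" "HOL-Combinatorics.Permutations"
begin

definition tile :: "nat \<Rightarrow> nat set \<Rightarrow> bool" where
  "tile r t \<longleftrightarrow> (\<exists>m k. k \<ge> 1 \<and> t = (\<lambda>j. m + j * r) ` {..<k})"

definition tilings :: "nat \<Rightarrow> nat \<Rightarrow> nat set set set" where
  "tilings r n = {T. partition_on {1..n} T \<and> (\<forall>t\<in>T. tile r t)}"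

text \<open>Integer partitions of \<open>n\<close> in frequency notation: \<open>a i\<close> is the multiplicity of the
  part \<open>i\<close>. The functions vanish outside \<open>{1..n}\<close>, so that each partition occurs exactly once.\<close>

definition int_partitions :: "nat \<Rightarrow> (nat \<Rightarrow> nat) set" where
  "int_partitions n = {a. (\<forall>i. i \<notin> {1..n} \<longrightarrow> a i = 0) \<and> (\<Sum>i=1..n. i * a i) = n}"

definition tiling_coeff :: "nat \<Rightarrow> nat \<Rightarrow> (nat \<Rightarrow> nat) \<Rightarrow> nat" where
  "tiling_coeff n r a = card {T \<in> tilings r n. \<forall>i\<in>{1..n}. card {t \<in> T. card t = i} = a i}"

definition num_perms_avoiding :: "nat \<Rightarrow> nat \<Rightarrow> nat \<Rightarrow> nat" where
  "num_perms_avoiding r s n =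
     card {\<pi>. \<pi> permutes {1..n} \<and>
       (\<forall>i. 1 \<le> i \<and> i + r \<le> n \<longrightarrow> \<bar>int (\<pi> (i + r)) - int (\<pi> i)\<bar> \<noteq> int s)}"

end

theory Submission
  imports Defs
begin

text \<open>
The formula is inclusion-exclusion over the set of positions \<open>i\<close> with a forbidden step
\<open>\<bar>\<pi> (i + r) - \<pi> i\<bar> = s\<close>. Joining \<open>i\<close> to \<open>i + r\<close> for each \<open>i\<close> in a set \<open>E\<close> of such positions cuts
\<open>{1..n}\<close> into maximal runs with difference \<open>r\<close>, that is, into an \<open>r\<close>-tiling, and every \<open>r\<close>-tiling
arises from exactly one \<open>E\<close> (\<open>bij_betw_links\<close>). A tiling with \<open>l\<close> tiles has \<open>n - l\<close> links
(\<open>card_links\<close>), whence the sign.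

It remains to count the permutations that take a forbidden step along every link of a given
\<open>r\<close>-tiling \<open>T\<close>. Along one tile such a permutation is an injective walk with steps \<open>\<plusminus> s\<close>; an injective
walk of this kind cannot reverse its direction (\<open>injective_walk_monotone\<close>), so the tile is mapped
onto an \<open>s\<close>-tile of the same size, increasingly or decreasingly. Thus the permutation carries \<open>T\<close> to an
\<open>s\<close>-tiling \<open>T'\<close> with the same multiset of tile sizes \<open>a\<close> (\<open>perms_stepping_along_links\<close>). Conversely, for
fixed \<open>T\<close> and \<open>T'\<close> of type \<open>a\<close> there are \<open>a i!\<close> ways to match the tiles of each size \<open>i\<close>, and two
orientations for each tile with at least two elements (\<open>card_tile_maps\<close>). Summing over \<open>T\<close> and \<open>T'\<close>,
grouped by their common type, gives the products of the two tiling coefficients.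
\<close>

section \<open>Tiles as arithmetic progressions\<close>

definition progression :: "nat \<Rightarrow> nat \<Rightarrow> nat \<Rightarrow> nat set" where
  "progression d m k = (\<lambda>j. m + j * d) ` {..<k}"

lemma tile_iff_progression: "tile d t \<longleftrightarrow> (\<exists>m k. k \<ge> 1 \<and> t = progression d m k)"
  by (simp add: tile_def progression_def)

lemma inj_on_progression: "d \<ge> 1 \<Longrightarrow> inj_on (\<lambda>j. m + j * d) A" for d m :: nat
  by (auto simp: inj_on_def)

lemma card_progression: "d \<ge> 1 \<Longrightarrow> card (progression d m k) = k"
  by (simp add: progression_def card_image inj_on_progression)

lemma progression_link:
  assumes "d \<ge> 1"
  shows "i \<in> progression d m k \<and> i + d \<in> progression d m k \<longleftrightarrow> (\<exists>j. Suc j < k \<and> i = m + j * d)"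
proof
  assume "i \<in> progression d m k \<and> i + d \<in> progression d m k"
  then obtain j j' where j: "i = m + j * d" "j < k" "i + d = m + j' * d" "j' < k"
    unfolding progression_def by blast
  have "j' * d = Suc j * d" using j by simp
  then have "j' = Suc j" using assms by (metis mult_cancel2 not_one_le_zero)
  then show "\<exists>j. Suc j < k \<and> i = m + j * d" using j by auto
next
  assume "\<exists>j. Suc j < k \<and> i = m + j * d"
  then obtain j where j: "Suc j < k" "i = m + j * d" by blast
  have "i + d = m + Suc j * d" using j by simp
  then show "i \<in> progression d m k \<and> i + d \<in> progression d m k"
    using j unfolding progression_def by (metis (no_types, lifting) Suc_lessD imageI lessThan_iff)
qed

lemma finite_tile: "tile d t \<Longrightarrow> finite t"
  by (auto simp: tile_def)

lemma tile_nonempty: "tile d t \<Longrightarrow> t \<noteq> {}"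
  by (auto simp: tile_def image_is_empty lessThan_empty_iff)

section \<open>Injective maps with constant step size along a tile\<close>

definition steps_by :: "nat \<Rightarrow> nat \<Rightarrow> (nat \<Rightarrow> nat) \<Rightarrow> nat set \<Rightarrow> bool" where
  "steps_by r s f t \<longleftrightarrow> (\<forall>i. i \<in> t \<and> i + r \<in> t \<longrightarrow> \<bar>int (f (i + r)) - int (f i)\<bar> = int s)"

lemma steps_by_progression:
  assumes "r \<ge> 1"
  shows "steps_by r s f (progression r m k) \<longleftrightarrow>
    (\<forall>j. Suc j < k \<longrightarrow> \<bar>int (f (m + Suc j * r)) - int (f (m + j * r))\<bar> = int s)"
  unfolding steps_by_def progression_link[OF assms] by (auto simp: algebra_simps)

text \<open>An injective walk with steps \<open>\<plusminus> s\<close> cannot turn around: a step undoing the previous one would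
revisit a value. The decreasing case is written from its last (least) value \<open>u (k - 1)\<close>, so that no
subtraction occurs on the value side.\<close>

lemma injective_walk_monotone:
  fixes u :: "nat \<Rightarrow> nat"
  assumes inj: "inj_on u {..<k}"
    and step: "\<And>j. Suc j < k \<Longrightarrow> \<bar>int (u (Suc j)) - int (u j)\<bar> = int s"
  shows "(\<forall>j<k. u j = u 0 + j * s) \<or> (\<forall>j<k. u j = u (k - 1) + (k - 1 - j) * s)"
proof -
  have "\<exists>e\<in>{1, -1}. \<forall>j<k. int (u j) = int (u 0) + e * int j * int s"
    using assms
  proof (induction k)
    case (Suc k)
    have "inj_on u {..<k}" using Suc.prems(1) by (rule inj_on_subset) auto
    moreover have "\<bar>int (u (Suc j)) - int (u j)\<bar> = int s" if "Suc j < k" for j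
      using Suc.prems(2) that by simp
    ultimately obtain e :: int where e: "e \<in> {1, -1}" "\<forall>j<k. int (u j) = int (u 0) + e * int j * int s"
      using Suc.IH by blast
    consider "k = 0" | "k = 1" | l where "k = Suc (Suc l)"
      by (metis One_nat_def not0_implies_Suc)
    then show ?case
    proof cases
      case 1
      then show ?thesis by auto
    next
      case 2
      have "\<bar>int (u 1) - int (u 0)\<bar> = int s" using Suc.prems(2)[of 0] 2 by simp
      \<comment> \<open>The first step alone fixes the direction.\<close>
      then have "int (u 1) = int (u 0) + 1 * int 1 * int s \<or> int (u 1) = int (u 0) + (-1) * int 1 * int s"
        by auto
      then obtain e' :: int where "e' \<in> {1,-1}" "int (u 1) = int (u 0) + e' * int 1 * int s"
        by blast
      then show ?thesis using 2 by (intro bexI[of _ e']) (auto simp: less_Suc_eq)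
    next
      case 3
      have "\<bar>int (u k) - int (u (Suc l))\<bar> = int s" using Suc.prems(2)[of "Suc l"] 3 by simp
      moreover have "u k \<noteq> u l"
        using inj_onD[OF Suc.prems(1), of k l] 3 by auto
      moreover have l: "int (u l) = int (u 0) + e * int l * int s" using spec[OF e(2), of l] 3 by simp
      moreover have "int (u (Suc l)) = int (u 0) + e * int (Suc l) * int s" using spec[OF e(2), of "Suc l"] 3 by simp
      then have "int (u (Suc l)) = int (u l) + e * int s" unfolding l by (simp add: algebra_simps)
      \<comment> \<open>The last step has direction \<open>e\<close> as well, for otherwise \<open>u k = u l\<close>.\<close>
      ultimately have "int (u k) = int (u l) + 2 * e * int s" using e(1) by auto
      then have "int (u k) = int (u 0) + e * int k * int s" unfolding l 3 by (simp add: algebra_simps)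
      then show ?thesis using e less_Suc_eq by (intro bexI[of _ e]) metis+
    qed
  qed auto
  then obtain e :: int where e: "e \<in> {1, -1}" "\<forall>j<k. int (u j) = int (u 0) + e * int j * int s"
    by blast
  show ?thesis
  proof (cases "e = 1")
    case True
    have "u j = u 0 + j * s" if "j < k" for j
    proof -
      have "int (u j) = int (u 0 + j * s)" using spec[OF e(2), of j] that True by simp
      then show ?thesis by (simp only: of_nat_eq_iff)
    qed
    then show ?thesis by blast
  next
    case False
    then have e': "e = -1" using e by simp
    have "u j = u (k - 1) + (k - 1 - j) * s" if "j < k" for j
    proof -
      have "int (u j) = int (u 0) - int j * int s" using spec[OF e(2), of j] that e' by simp
      moreover have "int (u (k - 1)) = int (u 0) - int (k - 1) * int s" using spec[OF e(2), of "k - 1"] that e' by (simp add: algebra_simps)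
      moreover have "int (k - 1) = int (k - 1 - j) + int j" using that by simp
      ultimately have "int (u j) = int (u (k - 1)) + int (k - 1 - j) * int s"
        by (simp add: distrib_right)
      then have "int (u j) = int (u (k - 1) + (k - 1 - j) * s)" by (simp only: of_nat_add of_nat_mult)
      then show ?thesis by (simp only: of_nat_eq_iff)
    qed
    then show ?thesis by blast
  qed
qed

text \<open>Reading a progression backwards traverses the same set; this makes increasing and decreasing walks
have images of one common form.\<close>

lemma image_backward_progression:
  "(\<lambda>j. p + (k - 1 - j) * s) ` {..<k} = progression s p k" for k p s :: nat
proof -
  have "(\<lambda>j. k - 1 - j) ` {..<k} = {..<k}"
  proof
    show "{..<k} \<subseteq> (\<lambda>j. k - 1 - j) ` {..<k}"
    proof
      fix x assume "x \<in> {..<k}"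
      then show "x \<in> (\<lambda>j. k - 1 - j) ` {..<k}" by (intro image_eqI[of _ _ "k - 1 - x"]) auto
    qed
  qed auto
  then have "(\<lambda>j. p + j * s) ` ((\<lambda>j. k - 1 - j) ` {..<k}) = progression s p k"
    unfolding progression_def by simp
  then show ?thesis by (simp add: image_image)
qed

lemma inj_steps_on_progression:
  assumes r: "r \<ge> 1" and inj: "inj_on f (progression r m k)" and st: "steps_by r s f (progression r m k)"
  shows "\<exists>p. f ` progression r m k = progression s p k \<and>
    ((\<forall>j<k. f (m + j * r) = p + j * s) \<or> (\<forall>j<k. f (m + j * r) = p + (k - 1 - j) * s))"
proof -
  define u where "u j = f (m + j * r)" for j
  have im: "f ` progression r m k = u ` {..<k}"
    by (simp add: progression_def u_def image_image)
  have "inj_on (f \<circ> (\<lambda>j. m + j * r)) {..<k}"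
    using inj inj_on_progression[OF r] unfolding progression_def by (intro comp_inj_on) auto
  then have "inj_on u {..<k}" by (simp add: u_def[abs_def] comp_def)
  moreover have "\<bar>int (u (Suc j)) - int (u j)\<bar> = int s" if "Suc j < k" for j
    using st that unfolding steps_by_progression[OF r] u_def by blast
  ultimately consider "\<forall>j<k. u j = u 0 + j * s" | "\<forall>j<k. u j = u (k - 1) + (k - 1 - j) * s"
    using injective_walk_monotone[of u k s] by blast
  then show ?thesis
  proof cases
    case 1
    then have "u ` {..<k} = progression s (u 0) k"
      unfolding progression_def by (intro image_cong refl) blast
    then have "f ` progression r m k = progression s (u 0) k" unfolding im .
    then show ?thesis using 1 unfolding u_def by (intro exI) (rule conjI, assumption, rule disjI1)
  next
    case 2
    then have "u ` {..<k} = progression s (u (k - 1)) k"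
      unfolding image_backward_progression[symmetric] by (intro image_cong refl) blast
    then have "f ` progression r m k = progression s (u (k - 1)) k" unfolding im .
    then show ?thesis using 2 unfolding u_def by (intro exI) (rule conjI, assumption, rule disjI2)
  qed
qed

text \<open>The reason why two tilings, one for \<open>r\<close> and one for \<open>s\<close>, enter the formula: a run of positions
linked by forbidden steps is carried onto a run of values.\<close>

lemma tile_image:
  assumes "r \<ge> 1" and "tile r t" and "inj_on f t" and "steps_by r s f t"
  shows "tile s (f ` t)"
proof -
  obtain m k where "k \<ge> 1" and t: "t = progression r m k"
    using assms(2) by (auto simp: tile_iff_progression)
  moreover obtain p where "f ` t = progression s p k"
    using inj_steps_on_progression[OF assms(1)] assms(3,4) unfolding t by blast
  ultimately show ?thesis unfolding tile_iff_progression by blast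
qed

lemma progression_start_unique:
  assumes "k \<ge> 1" "progression s p k = progression s q k"
  shows "p = q"
proof -
  have *: "y \<le> x" if "k \<ge> 1" "progression s x k = progression s y k" for x y
  proof -
    have "x + 0 * s \<in> progression s x k" unfolding progression_def using that by (intro imageI) auto
    then have "x \<in> progression s y k" using that by simp
    then show ?thesis by (auto simp: progression_def)
  qed
  show ?thesis using *[of p q] *[of q p] assms by auto
qed

section \<open>Counting maps between families of tiles\<close>

text \<open>Extending maps by the identity outside \<open>\<Union>T\<close> makes them permutations of \<open>\<Union>T\<close> in the sense of
\<open>permutes\<close> when \<open>\<Union>T = \<Union>T'\<close>, and makes each map determined by its values on \<open>\<Union>T\<close>, so that counting is
meaningful.\<close>

definition tile_maps :: "nat \<Rightarrow> nat \<Rightarrow> nat set set \<Rightarrow> nat set set \<Rightarrow> (nat \<Rightarrow> nat) set" where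
  "tile_maps r s T T' = {f. (\<forall>x. x \<notin> \<Union>T \<longrightarrow> f x = x) \<and> bij_betw f (\<Union>T) (\<Union>T')
     \<and> (\<forall>t\<in>T. f ` t \<in> T' \<and> steps_by r s f t)}"

definition orientations :: "nat \<Rightarrow> nat" where
  "orientations k = (if k \<ge> 2 then 2 else 1)"

text \<open>Onto a given tile of the same size there are exactly the order-preserving and the order-reversing
map; they coincide precisely for singletons.\<close>

lemma card_tile_maps_single:
  assumes r: "r \<ge> 1" and s: "s \<ge> 1" and t: "tile r t" and t': "tile s t'" and c: "card t' = card t"
  shows "card (tile_maps r s {t} {t'}) = orientations (card t)"
proof -
  obtain m k where k: "k \<ge> 1" and tk: "t = progression r m k" using t by (auto simp: tile_iff_progression)
  obtain p where pk: "t' = progression s p k"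
    using t' c r s unfolding tk tile_iff_progression by (metis card_progression)
  define up where "up x = (if x \<in> t then p + ((x - m) div r) * s else x)" for x
  define down where "down x = (if x \<in> t then p + (k - 1 - (x - m) div r) * s else x)" for x
  have mem: "m + j * r \<in> t" if "j < k" for j using that by (auto simp: tk progression_def)
  have up: "up (m + j * r) = p + j * s" if "j < k" for j
    using mem[OF that] r by (simp add: up_def)
  have down: "down (m + j * r) = p + (k - 1 - j) * s" if "j < k" for j
    using mem[OF that] r by (simp add: down_def)
  have im: "f ` t = (\<lambda>j. f (m + j * r)) ` {..<k}" for f :: "nat \<Rightarrow> nat"
    by (simp add: tk progression_def image_image)
  have imup: "up ` t = t'" unfolding im using up by (auto simp: pk progression_def)
  have imdown: "down ` t = t'" unfolding im pk image_backward_progression[symmetric] using down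
    by (intro image_cong) auto
  have fin: "finite t" using finite_tile[OF t] .
  have "inj_on up t" "inj_on down t" using imup imdown c fin by (auto intro: eq_card_imp_inj_on)
  then have bij: "bij_betw up t t'" "bij_betw down t t'" using imup imdown by (auto simp: bij_betw_def)
  have "steps_by r s up t" unfolding tk steps_by_progression[OF r]
  proof (intro allI impI)
    fix j assume j: "Suc j < k"
    then show "\<bar>int (up (m + Suc j * r)) - int (up (m + j * r))\<bar> = int s"
      using up[of j] up[of "Suc j"] by (simp add: algebra_simps)
  qed
  moreover have "steps_by r s down t" unfolding tk steps_by_progression[OF r]
  proof (intro allI impI)
    fix j assume j: "Suc j < k"
    then have "k - 1 - j = Suc (k - 1 - Suc j)" by simp
    then show "\<bar>int (down (m + Suc j * r)) - int (down (m + j * r))\<bar> = int s"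
      using down[of j] down[of "Suc j"] j by simp
  qed
  ultimately have sub: "{up, down} \<subseteq> tile_maps r s {t} {t'}"
    using bij imup imdown by (auto simp: tile_maps_def up_def down_def)
  have "tile_maps r s {t} {t'} \<subseteq> {up, down}"
  proof
    fix f assume f: "f \<in> tile_maps r s {t} {t'}"
    then have off: "\<And>x. x \<notin> t \<Longrightarrow> f x = x" and "inj_on f t" and ft: "f ` t = t'" and "steps_by r s f t"
      by (auto simp: tile_maps_def bij_betw_def)
    then obtain q where q: "f ` t = progression s q k" and
      *: "(\<forall>j<k. f (m + j * r) = q + j * s) \<or> (\<forall>j<k. f (m + j * r) = q + (k - 1 - j) * s)"
      using inj_steps_on_progression[OF r] unfolding tk by blast
    have "q = p" using progression_start_unique[OF k] q ft pk by metis
    with * consider "\<forall>j<k. f (m + j * r) = up (m + j * r)" | "\<forall>j<k. f (m + j * r) = down (m + j * r)"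
      using up down by auto
    then show "f \<in> {up, down}"
    proof cases
      case 1
      have "f x = up x" for x
        using 1 off by (cases "x \<in> t") (auto simp: tk progression_def up_def)
      then show ?thesis by auto
    next
      case 2
      have "f x = down x" for x
        using 2 off by (cases "x \<in> t") (auto simp: tk progression_def down_def)
      then show ?thesis by auto
    qed
  qed
  with sub have eq: "tile_maps r s {t} {t'} = {up, down}" by blast
  have ck: "card t = k" by (simp add: tk card_progression[OF r])
  show ?thesis
  proof (cases "k \<ge> 2")
    case True
    have "up (m + 0 * r) \<noteq> down (m + 0 * r)" using up[of 0] down[of 0] True s by auto
    then have "up \<noteq> down" by metis
    then show ?thesis unfolding eq ck using True by (simp add: orientations_def)
  next
    case False
    then have "k = 1" using k by simp
    then have "up x = down x" for x using up[of 0] down[of 0]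
      by (cases "x \<in> t") (auto simp: tk progression_def up_def down_def)
    then have "up = down" by auto
    then show ?thesis unfolding eq ck using False by (simp add: orientations_def)
  qed
qed

lemma steps_by_cong: "(\<And>x. x \<in> t \<Longrightarrow> f x = g x) \<Longrightarrow> steps_by r s f t \<longleftrightarrow> steps_by r s g t"
  by (auto simp: steps_by_def)

text \<open>Once the image of one tile is prescribed, the restrictions to that tile and to the other tiles are
independent. This is the step of the recursion for the count of all tile maps.\<close>

lemma card_tile_maps_split:
  assumes t0: "t0 \<notin> T" and dj: "disjoint (insert t0 T)" and ne: "{} \<notin> T"
    and dj': "disjoint T'" and t': "t' \<in> T'"
  shows "card {f \<in> tile_maps r s (insert t0 T) T'. f ` t0 = t'} =
    card (tile_maps r s {t0} {t'}) * card (tile_maps r s T (T' - {t'}))"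
proof -
  define D where "D = \<Union>T"
  define D' where "D' = \<Union>(T' - {t'})"
  have D: "t0 \<inter> D = {}" using t0 dj unfolding D_def by (auto simp: pairwise_def disjnt_iff)
  have D': "t' \<inter> D' = {}" using t' dj' unfolding D'_def by (auto simp: pairwise_def disjnt_iff)
  have U': "\<Union>T' = t' \<union> D'" using t' unfolding D'_def by auto
  have U: "\<Union>(insert t0 T) = t0 \<union> D" by (simp add: D_def)
  have tD: "t \<subseteq> D" if "t \<in> T" for t using that by (auto simp: D_def)
  let ?L = "{f \<in> tile_maps r s (insert t0 T) T'. f ` t0 = t'}"
  let ?R = "tile_maps r s {t0} {t'} \<times> tile_maps r s T (T' - {t'})"
  define split_map where "split_map f = ((\<lambda>x. if x \<in> t0 then f x else x), (\<lambda>x. if x \<in> D then f x else x))"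
    for f :: "nat \<Rightarrow> nat"
  define glue where "glue gh = (\<lambda>x. if x \<in> t0 then fst gh x else snd gh x)"
    for gh :: "(nat \<Rightarrow> nat) \<times> (nat \<Rightarrow> nat)"
  have "bij_betw split_map ?L ?R"
  proof (rule bij_betw_byWitness[of _ glue])
    show "\<forall>f\<in>?L. glue (split_map f) = f"
      by (auto simp: glue_def split_map_def fun_eq_iff tile_maps_def D_def)
    show "\<forall>gh\<in>?R. split_map (glue gh) = gh"
    proof
      fix gh assume gh: "gh \<in> ?R"
      have 1: "(\<lambda>x. if x \<in> t0 then glue gh x else x) = fst gh"
        using gh by (auto simp: glue_def fun_eq_iff tile_maps_def)
      have 2: "(\<lambda>x. if x \<in> D then glue gh x else x) = snd gh"
        using gh D by (auto simp: glue_def fun_eq_iff tile_maps_def D_def)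
      show "split_map (glue gh) = gh" unfolding split_map_def 1 2 by simp
    qed
    show "split_map ` ?L \<subseteq> ?R"
    proof
      fix gh assume "gh \<in> split_map ` ?L"
      then obtain f where f: "f \<in> tile_maps r s (insert t0 T) T'" "f ` t0 = t'" and gh: "gh = split_map f"
        by auto
      have b: "bij_betw f (t0 \<union> D) (t' \<union> D')" using f unfolding tile_maps_def U U' by auto
      have b0: "bij_betw f t0 t'" using b f(2) by (auto simp: bij_betw_def inj_on_Un)
      have "bij_betw f ((t0 \<union> D) - t0) ((t' \<union> D') - t')"
        by (rule bij_betw_DiffI[OF b b0]) auto
      moreover have "(t0 \<union> D) - t0 = D" "(t' \<union> D') - t' = D'" using D D' by auto
      ultimately have bD: "bij_betw f D D'" by simp
      define g where "g = (\<lambda>x. if x \<in> t0 then f x else x)"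
      define h where "h = (\<lambda>x. if x \<in> D then f x else x)"
      have "bij_betw g t0 t'" using b0 by (subst bij_betw_cong[of _ _ f]) (auto simp: g_def)
      moreover have "g ` t0 = t'" using f(2) by (simp add: g_def)
      moreover have "steps_by r s g t0" using f(1)
        by (subst steps_by_cong[of _ _ f]) (auto simp: g_def tile_maps_def)
      ultimately have "g \<in> tile_maps r s {t0} {t'}"
        by (simp add: tile_maps_def) (simp add: g_def)
      moreover have "h \<in> tile_maps r s T (T' - {t'})"
        unfolding tile_maps_def D_def[symmetric] D'_def[symmetric]
      proof (intro CollectI conjI ballI)
        show "\<forall>x. x \<notin> D \<longrightarrow> h x = x" by (simp add: h_def)
        show "bij_betw h D D'" using bD by (subst bij_betw_cong[of _ _ f]) (auto simp: h_def)
        fix t assume t: "t \<in> T"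
        have ht: "h x = f x" if "x \<in> t" for x using tD[OF t] that by (auto simp: h_def)
        then have im: "h ` t = f ` t" by auto
        have "f ` t \<in> T'" "steps_by r s f t" using f(1) t by (auto simp: tile_maps_def)
        moreover have "f ` t \<subseteq> D'" using tD[OF t] bD by (auto simp: bij_betw_def)
        moreover have "f ` t \<noteq> {}" using ne t by auto
        ultimately show "h ` t \<in> T' - {t'}" "steps_by r s h t" 
          using D' im steps_by_cong[of t h f r s] ht by auto
      qed
      ultimately show "gh \<in> ?R" unfolding gh split_map_def g_def h_def by simp
    qed
    show "glue ` ?R \<subseteq> ?L"
    proof
      fix f assume "f \<in> glue ` ?R"
      then obtain g h where g: "g \<in> tile_maps r s {t0} {t'}" and h: "h \<in> tile_maps r s T (T' - {t'})"
        and f: "f = glue (g, h)" by auto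
      have fg: "f x = g x" if "x \<in> t0" for x using that by (simp add: f glue_def)
      have fh: "f x = h x" if "x \<in> D" for x using that D by (auto simp: f glue_def)
      have "bij_betw g t0 t'" using g by (simp add: tile_maps_def)
      then have b0: "bij_betw f t0 t'" using fg by (subst bij_betw_cong[of _ _ g]) auto
      have "bij_betw h D D'" using h by (simp add: tile_maps_def D_def D'_def)
      then have "bij_betw f D D'" using fh by (subst bij_betw_cong[of _ _ h]) auto
      then have b: "bij_betw f (t0 \<union> D) (t' \<union> D')" using b0 D' by (intro bij_betw_combine)
      have im0: "f ` t0 = t'" using b0 by (simp add: bij_betw_def)
      have "f \<in> tile_maps r s (insert t0 T) T'"
        unfolding tile_maps_def U U'
      proof (intro CollectI conjI ballI)
        show "bij_betw f (t0 \<union> D) (t' \<union> D')" by fact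
        show "\<forall>x. x \<notin> t0 \<union> D \<longrightarrow> f x = x"
          using h by (auto simp: f glue_def tile_maps_def D_def)
        fix t assume "t \<in> insert t0 T"
        then consider "t = t0" | "t \<in> T" by auto
        then have "f ` t \<in> T' \<and> steps_by r s f t"
        proof cases
          case 1
          then show ?thesis using im0 t' g steps_by_cong[of t0 f g r s] fg by (auto simp: tile_maps_def)
        next
          case 2
          then have e: "f x = h x" if "x \<in> t" for x using tD that fh by auto
          then have "f ` t = h ` t" by auto
          then show ?thesis using 2 h steps_by_cong[of t f h r s] e by (auto simp: tile_maps_def)
        qed
        then show "f ` t \<in> T'" "steps_by r s f t" by auto
      qed
      then show "f \<in> ?L" using im0 by simp
    qed
  qed
  then show ?thesis by (simp add: bij_betw_same_card card_cartesian_product)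
qed

definition size_count :: "nat set set \<Rightarrow> nat \<Rightarrow> nat" where
  "size_count T i = card {t \<in> T. card t = i}"

lemma size_count_insert:
  assumes "finite T" and "t \<notin> T"
  shows "size_count (insert t T) i = (if i = card t then Suc (size_count T i) else size_count T i)"
proof (cases "i = card t")
  case True
  then have "{u \<in> insert t T. card u = i} = insert t {u \<in> T. card u = i}" by auto
  then show ?thesis using assms True by (simp add: size_count_def)
next
  case False
  then have "{u \<in> insert t T. card u = i} = {u \<in> T. card u = i}" by auto
  then show ?thesis using False by (simp add: size_count_def)
qed

text \<open>Remove a tile of size \<open>k\<close> from \<open>T\<close>: its image is any of the \<open>size_count T' k\<close> tiles of that size in \<open>T'\<close>,
after which the multiplicity of \<open>k\<close> drops by one on both sides. Iterating produces the factorials,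
and each tile contributes its number of orientations. The index set \<open>I\<close> may exceed the sizes that
occur, since absent sizes contribute \<open>fact 0 = 1\<close>; this keeps it constant during the induction.\<close>

lemma card_tile_maps:
  assumes r: "r \<ge> 1" and s: "s \<ge> 1" and "finite T" and "disjoint T" and "\<forall>t\<in>T. tile r t"
    and "finite T'" and "disjoint T'" and "\<forall>t\<in>T'. tile s t"
    and "size_count T = size_count T'" and "finite I" and "card ` T \<subseteq> I"
  shows "card (tile_maps r s T T') = (\<Prod>i\<in>I. fact (size_count T i)) * (\<Prod>t\<in>T. orientations (card t))"
  using assms(3-)
proof (induction T arbitrary: T' rule: finite_induct)
  case empty
  have "T' = {}"
  proof (rule ccontr)
    assume "T' \<noteq> {}"
    then obtain t where t: "t \<in> T'" by blast
    have "size_count T' (card t) = 0" using empty.prems(6) by (simp add: size_count_def fun_eq_iff)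
    then show False using t empty.prems(3) by (auto simp: size_count_def)
  qed
  then have "tile_maps r s {} T' = {\<lambda>x. x}" by (auto simp: tile_maps_def bij_betw_def)
  then show ?case by (simp add: size_count_def)
next
  case (insert t0 T)
  define C where "C = {t' \<in> T'. card t' = card t0}"
  let ?P = "(\<Prod>i\<in>I. fact (size_count T i)) :: nat" and ?O = "\<Prod>t\<in>T. orientations (card t)"
  have finC: "finite C" using insert.prems by (simp add: C_def)
  have t0: "tile r t0" and T: "\<forall>t\<in>T. tile r t" using insert.prems by auto
  have dj: "disjoint T" using insert.prems by (simp add: pairwise_insert)
  have cardC: "card C = Suc (size_count T (card t0))"
    using insert.prems(6) size_count_insert[OF insert.hyps, of "card t0"]
    by (simp add: C_def size_count_def fun_eq_iff)
  have each: "card {f \<in> tile_maps r s (insert t0 T) T'. f ` t0 = t'} = orientations (card t0) * (?P * ?O)"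
    if "t' \<in> C" for t'
  proof -
    have t': "t' \<in> T'" "card t' = card t0" using that by (auto simp: C_def)
    have "size_count T i = size_count (T' - {t'}) i" for i
    proof -
      have "size_count (insert t0 T) i = size_count (insert t' (T' - {t'})) i"
        using insert.prems(6) t'(1) by (simp add: insert_absorb)
      moreover have "size_count (insert t' (T' - {t'})) i =
          (if i = card t0 then Suc (size_count (T' - {t'}) i) else size_count (T' - {t'}) i)"
        unfolding t'(2)[symmetric] using insert.prems(3) by (intro size_count_insert) auto
      ultimately show ?thesis unfolding size_count_insert[OF insert.hyps] by (simp split: if_splits)
    qed
    then have "card (tile_maps r s T (T' - {t'})) = ?P * ?O"
      using insert.prems dj T by (intro insert.IH) (auto simp: pairwise_def)
    moreover have "card (tile_maps r s {t0} {t'}) = orientations (card t0)"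
      using insert.prems(5) t' t0 by (intro card_tile_maps_single[OF r s]) auto
    moreover have "{} \<notin> T" using T tile_nonempty by blast
    ultimately show ?thesis
      using card_tile_maps_split[OF insert.hyps(2) insert.prems(1) _ insert.prems(4) t'(1), of r s] by simp
  qed
  have Un: "tile_maps r s (insert t0 T) T' = (\<Union>t'\<in>C. {f \<in> tile_maps r s (insert t0 T) T'. f ` t0 = t'})"
  proof -
    have "f ` t0 \<in> C" if "f \<in> tile_maps r s (insert t0 T) T'" for f
    proof -
      have "inj_on f t0" using that by (auto simp: tile_maps_def bij_betw_def intro: inj_on_subset)
      then show ?thesis using that by (auto simp: tile_maps_def C_def card_image)
    qed
    then show ?thesis by auto
  qed
  have fin: "finite {f \<in> tile_maps r s (insert t0 T) T'. f ` t0 = t'}" if "t' \<in> C" for t'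
  proof (rule card_ge_0_finite)
    show "card {f \<in> tile_maps r s (insert t0 T) T'. f ` t0 = t'} > 0"
      unfolding each[OF that] using insert.prems(7) by (auto simp: orientations_def intro!: prod_pos)
  qed
  have "card (tile_maps r s (insert t0 T) T') = (\<Sum>t'\<in>C. card {f \<in> tile_maps r s (insert t0 T) T'. f ` t0 = t'})"
    by (subst Un, rule card_UN_disjoint) (use finC fin in auto)
  also have "\<dots> = card C * (orientations (card t0) * (?P * ?O))" using each by simp
  also have "\<dots> = (card C * ?P) * (\<Prod>t\<in>insert t0 T. orientations (card t))"
    using insert.hyps by simp
  also have "card C * ?P = (\<Prod>i\<in>I. fact (size_count (insert t0 T) i))"
  proof -
    have I: "card t0 \<in> I" using insert.prems by auto
    have "(\<Prod>i\<in>I - {card t0}. fact (size_count (insert t0 T) i)) = (\<Prod>i\<in>I - {card t0}. fact (size_count T i) :: nat)"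
      by (intro prod.cong refl) (simp add: size_count_insert[OF insert.hyps])
    then show ?thesis
      using prod.remove[OF insert.prems(7) I, of "\<lambda>i. fact (size_count T i) :: nat"]
        prod.remove[OF insert.prems(7) I, of "\<lambda>i. fact (size_count (insert t0 T) i) :: nat"]
      by (simp add: size_count_insert[OF insert.hyps] cardC algebra_simps)
  qed
  finally show ?case .
qed

section \<open>Tilings and their sets of links\<close>

text \<open>A tiling is encoded by the positions that are joined to their successor in the same tile. This turns
tilings into subsets, over which inclusion-exclusion can sum.\<close>

definition links :: "nat \<Rightarrow> nat set set \<Rightarrow> nat set" where
  "links r T = {i. \<exists>t\<in>T. i \<in> t \<and> i + r \<in> t}"

lemma tilingsD:
  assumes "T \<in> tilings r n"
  shows "partition_on {1..n} T" "\<Union>T = {1..n}" "disjoint T" "{} \<notin> T" "finite T" "\<forall>t\<in>T. tile r t"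
  using assms finite_elements[of "{1..n}" T] by (auto simp: tilings_def partition_on_def)

lemma tilings_block_unique: "T \<in> tilings r n \<Longrightarrow> t \<in> T \<Longrightarrow> u \<in> T \<Longrightarrow> x \<in> t \<Longrightarrow> x \<in> u \<Longrightarrow> t = u"
  using tilingsD(3)[of T r n] by (meson disjnt_iff pairwiseD)

text \<open>Following the links from the least element of \<open>t\<close> never leaves the block of \<open>T\<close> that contains it.\<close>

lemma linked_tile_subset:
  assumes "tile r t" and T: "T \<in> tilings r n" and "t \<subseteq> {1..n}"
    and linked: "\<And>i. i \<in> t \<Longrightarrow> i + r \<in> t \<Longrightarrow> i \<in> links r T"
  shows "\<exists>u\<in>T. t \<subseteq> u"
proof -
  obtain m k where k: "k \<ge> 1" and t: "t = progression r m k"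
    using assms(1) by (auto simp: tile_iff_progression)
  have mem: "m + j * r \<in> t" if "j < k" for j using that by (auto simp: t progression_def)
  have "m \<in> \<Union>T" using mem[of 0] k assms(3) tilingsD(2)[OF T] by auto
  then obtain u where u: "u \<in> T" "m \<in> u" by blast
  have "m + j * r \<in> u" if "j < k" for j
    using that
  proof (induction j)
    case (Suc j)
    have "m + j * r \<in> links r T"
      using mem[of j] mem[OF Suc.prems] Suc.prems by (intro linked) (auto simp: algebra_simps)
    then obtain v where "v \<in> T" "m + j * r \<in> v" "m + j * r + r \<in> v" by (auto simp: links_def)
    moreover from this have "v = u" using tilings_block_unique[OF T] u Suc by auto
    ultimately show ?case by (simp add: algebra_simps)
  qed (use u in simp)
  then show ?thesis using u by (auto simp: t progression_def)
qed

text \<open>If two tilings have the same links, then each tile of one lies in a tile of the other and conversely;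
going back and forth returns to the original tile because blocks are disjoint.\<close>

lemma inj_on_links: "inj_on (links r) (tilings r n)"
proof -
  have sub: "T \<subseteq> T'" if T: "T \<in> tilings r n" and T': "T' \<in> tilings r n" and eq: "links r T = links r T'" for T T'
  proof
    fix t assume t: "t \<in> T"
    have "t \<subseteq> {1..n}" using t tilingsD(2)[OF T] by auto
    moreover have "i \<in> links r T'" if "i \<in> t" "i + r \<in> t" for i
      unfolding eq[symmetric] using that t by (auto simp: links_def)
    ultimately obtain u where u: "u \<in> T'" "t \<subseteq> u"
      using linked_tile_subset[of r t T' n] t tilingsD(6)[OF T] T' by blast
    have "u \<subseteq> {1..n}" using u tilingsD(2)[OF T'] by auto
    moreover have "i \<in> links r T" if "i \<in> u" "i + r \<in> u" for i
      unfolding eq using that u by (auto simp: links_def)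
    ultimately obtain v where v: "v \<in> T" "u \<subseteq> v"
      using linked_tile_subset[of r u T n] u tilingsD(6)[OF T'] T by blast
    have "t \<noteq> {}" using t tilingsD(4)[OF T] by auto
    then have "t = v" using tilings_block_unique[OF T t v(1)] u v by auto
    then show "t \<in> T'" using u v by auto
  qed
  show ?thesis by (intro inj_onI equalityI sub) auto
qed

text \<open>The least element of the maximal run \<open>\<dots>, x - 2 * r, x - r, x\<close> that is joined by links in \<open>E\<close>. The fibres
of this function are the blocks of the tiling with links \<open>E\<close>; using fibres makes the partition property
immediate. The condition \<open>r \<le> x\<close> guards against truncated subtraction.\<close>

function chain_start :: "nat \<Rightarrow> nat set \<Rightarrow> nat \<Rightarrow> nat" where
  "chain_start r E x = (if 0 < r \<and> r \<le> x \<and> x - r \<in> E then chain_start r E (x - r) else x)"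
  by pat_completeness auto
termination by (relation "measure (\<lambda>(r, E, x). x)") auto

declare chain_start.simps [simp del]

lemma chain_start_le: "chain_start r E x \<le> x"
proof (induction r E x rule: chain_start.induct)
  case (1 r E x)
  then show ?case by (subst chain_start.simps) (auto intro: order_trans)
qed

lemma chain_start_pos: "0 \<notin> E \<Longrightarrow> x \<ge> 1 \<Longrightarrow> chain_start r E x \<ge> 1"
proof (induction r E x rule: chain_start.induct)
  case (1 r E x)
  then have "x - r \<in> E \<Longrightarrow> x - r \<ge> 1" by (cases "x - r") auto
  then show ?case using 1 by (subst chain_start.simps) auto
qed

text \<open>All intermediate points between \<open>x\<close> and the start of its run have the same start. Hence a fibre is a
gap-free progression, which is what makes it a tile.\<close>

lemma chain_start_progression:
  "\<exists>j. x = chain_start r E x + j * r \<and> (\<forall>i\<le>j. chain_start r E (chain_start r E x + i * r) = chain_start r E x)"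
proof (induction r E x rule: chain_start.induct)
  case (1 r E x)
  show ?case
  proof (cases "0 < r \<and> r \<le> x \<and> x - r \<in> E")
    case True
    let ?m = "chain_start r E (x - r)"
    have x: "chain_start r E x = ?m" using True by (subst chain_start.simps) simp
    obtain j where j: "x - r = ?m + j * r" "\<forall>i\<le>j. chain_start r E (?m + i * r) = ?m"
      using 1[OF True] by blast
    have "x = ?m + j * r + r" using j(1) True by linarith
    then have "x = ?m + Suc j * r" by simp
    then show ?thesis unfolding x using j(2) x by (intro exI[of _ "Suc j"]) (auto simp: le_Suc_eq)
  next
    case False
    then have "chain_start r E x = x" by (subst chain_start.simps) auto
    then show ?thesis by (intro exI[of _ 0]) simp
  qed
qed

lemma finite_downclosed_nat:
  assumes "finite J" and "0 \<in> J" and "\<And>i j. j \<in> J \<Longrightarrow> i \<le> j \<Longrightarrow> i \<in> J"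
  shows "J = {..<Suc (Max J)}"
proof -
  have "Max J \<in> J" using assms(1,2) by (intro Max_in) auto
  then have "j \<in> J \<longleftrightarrow> j \<le> Max J" for j using assms(3) Max_ge[OF assms(1)] by blast
  then show ?thesis unfolding lessThan_Suc_atMost by blast
qed

text \<open>The blocks are the fibres of \<open>chain_start\<close>. If \<open>i \<in> E\<close> then \<open>i\<close> and \<open>i + r\<close> have the same start by
definition; if \<open>i \<notin> E\<close> then \<open>i + r\<close> is its own start, which exceeds the start of \<open>i\<close>.\<close>

lemma tiling_with_links:
  assumes r: "r \<ge> 1" and E: "E \<subseteq> {i. 1 \<le> i \<and> i + r \<le> n}"
  shows "\<exists>T\<in>tilings r n. links r T = E"
proof -
  let ?c = "chain_start r E"
  define block where "block m = {x \<in> {1..n}. ?c x = m}" for m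
  define T where "T = (\<lambda>y. block (?c y)) ` {1..n}"
  have E0: "0 \<notin> E" using E by auto
  have step: "?c (i + r) = (if i \<in> E then ?c i else i + r)" for i
    using r by (subst chain_start.simps) auto
  have "tile r (block (?c y))" if y: "y \<in> {1..n}" for y
  proof -
    let ?m = "?c y"
    \<comment> \<open>The fibre in terms of multiples of \<open>r\<close>; it is a tile as soon as \<open>J\<close> is an initial segment.\<close>
    define J where "J = {j. ?c (?m + j * r) = ?m \<and> ?m + j * r \<le> n}"
    have "J \<subseteq> {..n}"
    proof
      fix j assume "j \<in> J"
      then have "j * r \<le> n" by (simp add: J_def)
      moreover have "j * 1 \<le> j * r" using r by (intro mult_le_mono2)
      ultimately show "j \<in> {..n}" unfolding atMost_iff by linarith
    qed
    then have "finite J" by (rule finite_subset) simp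
    moreover have "0 \<in> J" using chain_start_progression[of y r E] y chain_start_le[of r E y] by (auto simp: J_def)
    moreover have "i \<in> J" if j: "j \<in> J" and "i \<le> j" for i j
    proof -
      obtain l where l: "?m + j * r = ?m + l * r" "\<forall>i\<le>l. ?c (?m + i * r) = ?m"
        using chain_start_progression[of "?m + j * r" r E] j by (auto simp: J_def)
      have "l = j" using l(1) r by simp
      moreover have "i * r \<le> j * r" using \<open>i \<le> j\<close> by (rule mult_le_mono1)
      moreover have "?m + j * r \<le> n" using j by (simp add: J_def)
      ultimately have "?m + i * r \<le> n" "?c (?m + i * r) = ?m" using l(2) \<open>i \<le> j\<close> by (linarith, blast)
      then show ?thesis by (simp add: J_def)
    qed
    ultimately have J: "J = {..<Suc (Max J)}" by (rule finite_downclosed_nat)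
    have "block ?m = (\<lambda>j. ?m + j * r) ` J"
    proof
      show "block ?m \<subseteq> (\<lambda>j. ?m + j * r) ` J"
      proof
        fix x assume x: "x \<in> block ?m"
        then obtain j where "x = ?m + j * r"
          using chain_start_progression[of x r E] by (auto simp: block_def)
        then show "x \<in> (\<lambda>j. ?m + j * r) ` J" using x by (intro image_eqI[of _ _ j]) (auto simp: J_def block_def)
      qed
      have "?m \<ge> 1" using chain_start_pos[OF E0] y by auto
      then show "(\<lambda>j. ?m + j * r) ` J \<subseteq> block ?m" by (auto simp: J_def block_def)
    qed
    then have "block ?m = progression r ?m (Suc (Max J))" unfolding progression_def using J by simp
    then show ?thesis unfolding tile_iff_progression by (intro exI conjI) auto
  qed
  moreover have "partition_on {1..n} T"
    by (intro partition_onI) (auto simp: T_def block_def disjnt_iff)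
  ultimately have T: "T \<in> tilings r n" by (auto simp: tilings_def T_def)
  have "links r T = E"
  proof (intro equalityI subsetI)
    fix i assume "i \<in> links r T"
    then have "?c (i + r) = ?c i" by (auto simp: links_def T_def block_def)
    then show "i \<in> E" using step[of i] chain_start_le[of r E i] r by (auto split: if_splits)
  next
    fix i assume i: "i \<in> E"
    then have "?c (i + r) = ?c i" "i \<in> {1..n}" "i + r \<in> {1..n}" using step E by auto
    then have "block (?c i) \<in> T" "i \<in> block (?c i)" "i + r \<in> block (?c i)"
      by (auto simp: T_def block_def)
    then show "i \<in> links r T" unfolding links_def by blast
  qed
  then show ?thesis using T by blast
qed

lemma bij_betw_links:
  assumes "r \<ge> 1"
  shows "bij_betw (links r) (tilings r n) (Pow {i. 1 \<le> i \<and> i + r \<le> n})"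
proof -
  have "links r T \<in> Pow {i. 1 \<le> i \<and> i + r \<le> n}" if "T \<in> tilings r n" for T
    using tilingsD(2)[OF that] by (fastforce simp: links_def)
  moreover have "E \<in> links r ` tilings r n" if "E \<in> Pow {i. 1 \<le> i \<and> i + r \<le> n}" for E
    using tiling_with_links[OF assms] that by (metis PowD image_eqI)
  ultimately show ?thesis using inj_on_links by (auto simp: bij_betw_def)
qed

text \<open>A tile with \<open>k\<close> elements contains \<open>k - 1\<close> links. This fixes the sign that inclusion-exclusion attaches
to a tiling.\<close>

lemma card_links:
  assumes r: "r \<ge> 1" and T: "T \<in> tilings r n"
  shows "card (links r T) + card T = n"
proof -
  have each: "card {i. i \<in> t \<and> i + r \<in> t} + 1 = card t" if t: "t \<in> T" for t
  proof -
    obtain m k where k: "k \<ge> 1" and tk: "t = progression r m k"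
      using tilingsD(6)[OF T] t by (auto simp: tile_iff_progression)
    have "{i. i \<in> t \<and> i + r \<in> t} = progression r m (k - 1)"
      unfolding tk progression_link[OF r]
      unfolding progression_def by (auto simp: image_def Bex_def less_diff_conv)
    then show ?thesis using k by (simp add: tk card_progression[OF r])
  qed
  have fin: "finite {i. i \<in> t \<and> i + r \<in> t}" if t: "t \<in> T" for t
    using tilingsD(6)[OF T] t finite_tile by (auto intro: finite_subset[of _ t])
  have "links r T = (\<Union>t\<in>T. {i. i \<in> t \<and> i + r \<in> t})" by (auto simp: links_def)
  also have "card \<dots> = (\<Sum>t\<in>T. card {i. i \<in> t \<and> i + r \<in> t})"
    using tilingsD(5)[OF T] fin tilings_block_unique[OF T] by (intro card_UN_disjoint) auto
  finally have "card (links r T) + card T = (\<Sum>t\<in>T. card {i. i \<in> t \<and> i + r \<in> t} + 1)"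
    by (simp add: sum.distrib del: add_Suc_right)
  also have "\<dots> = (\<Sum>t\<in>T. card t)" using each by (intro sum.cong) auto
  also have "\<dots> = n"
    using product_partition[OF tilingsD(1)[OF T]] finite_tile tilingsD(6)[OF T] by force
  finally show ?thesis .
qed

section \<open>Permutations with prescribed forbidden steps\<close>

definition forbidden_steps :: "nat \<Rightarrow> nat \<Rightarrow> nat \<Rightarrow> (nat \<Rightarrow> nat) \<Rightarrow> nat set" where
  "forbidden_steps r s n \<pi> = {i. 1 \<le> i \<and> i + r \<le> n \<and> \<bar>int (\<pi> (i + r)) - int (\<pi> i)\<bar> = int s}"

text \<open>The target family is determined by the map, so the sets \<open>tile_maps r s T T'\<close> for different \<open>T'\<close> are
disjoint and can be counted separately.\<close>

lemma tile_maps_image_eq: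
  assumes f: "f \<in> tile_maps r s T T'" and dj: "disjoint T'" and ne: "{} \<notin> T'"
  shows "(`) f ` T = T'"
proof (intro equalityI subsetI)
  fix t' assume t': "t' \<in> T'"
  then obtain y where y: "y \<in> t'" using ne by (cases "t' = {}") auto
  then have "y \<in> f ` \<Union>T" using f t' by (auto simp: tile_maps_def bij_betw_def)
  then obtain t where t: "t \<in> T" "y \<in> f ` t" by blast
  then have "f ` t \<in> T'" using f by (auto simp: tile_maps_def)
  then have "f ` t = t'" using dj t' y t by (meson disjnt_iff pairwiseD)
  then show "t' \<in> (`) f ` T" using t by blast
qed (use f in \<open>auto simp: tile_maps_def\<close>)

lemma size_count_image:
  assumes "inj_on f (\<Union>T)"
  shows "size_count ((`) f ` T) = size_count T"
proof
  fix i
  have c: "card (f ` t) = card t" if "t \<in> T" for t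
    using assms that by (intro card_image) (auto intro: inj_on_subset)
  have "{u \<in> (`) f ` T. card u = i} = (`) f ` {t \<in> T. card t = i}"
    using c by auto
  moreover have "inj_on ((`) f) {t \<in> T. card t = i}"
    by (rule inj_on_subset[OF inj_on_image[OF assms]]) auto
  ultimately show "size_count ((`) f ` T) i = size_count T i"
    by (simp add: size_count_def card_image)
qed

text \<open>A permutation that steps by \<open>s\<close> along every link of \<open>T\<close> carries the tiles of \<open>T\<close> to \<open>s\<close>-tiles, and these
images form an \<open>s\<close>-tiling with the same tile sizes.\<close>

lemma perms_stepping_along_links:
  assumes r: "r \<ge> 1" and T: "T \<in> tilings r n"
  shows "{\<pi>. \<pi> permutes {1..n} \<and> links r T \<subseteq> forbidden_steps r s n \<pi>} =
    (\<Union>T'\<in>{T' \<in> tilings s n. size_count T' = size_count T}. tile_maps r s T T')"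
proof (intro equalityI subsetI)
  fix \<pi> assume "\<pi> \<in> {\<pi>. \<pi> permutes {1..n} \<and> links r T \<subseteq> forbidden_steps r s n \<pi>}"
  then have \<pi>: "\<pi> permutes {1..n}" and sub: "links r T \<subseteq> forbidden_steps r s n \<pi>" by auto
  have U: "\<Union>T = {1..n}" using tilingsD(2)[OF T] .
  have inj: "inj_on \<pi> (\<Union>T)" using permutes_inj_on[OF \<pi>] .
  have steps: "steps_by r s \<pi> t" if "t \<in> T" for t
    using sub that by (auto simp: steps_by_def links_def forbidden_steps_def)
  have "partition_on (\<pi> ` {1..n}) ((`) \<pi> ` T - {{}})"
    using partition_on_inj_image[OF tilingsD(1)[OF T]] inj U by simp
  moreover have "(`) \<pi> ` T - {{}} = (`) \<pi> ` T" using tilingsD(4)[OF T] by auto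
  ultimately have "partition_on {1..n} ((`) \<pi> ` T)" by (simp only: permutes_image[OF \<pi>])
  moreover have "tile s (\<pi> ` t)" if t: "t \<in> T" for t
    using t tilingsD(6)[OF T] steps[OF t] inj by (intro tile_image[OF r]) (auto intro: inj_on_subset)
  ultimately have "(`) \<pi> ` T \<in> tilings s n" by (auto simp: tilings_def)
  moreover have "\<pi> \<in> tile_maps r s T ((`) \<pi> ` T)"
    using steps inj permutes_not_in[OF \<pi>] unfolding tile_maps_def U[symmetric]
    by (auto simp: bij_betw_def image_Union)
  ultimately show "\<pi> \<in> (\<Union>T'\<in>{T' \<in> tilings s n. size_count T' = size_count T}. tile_maps r s T T')"
    using size_count_image[OF inj] by blast
next
  fix \<pi> assume "\<pi> \<in> (\<Union>T'\<in>{T' \<in> tilings s n. size_count T' = size_count T}. tile_maps r s T T')"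
  then obtain T' where T': "T' \<in> tilings s n" and \<pi>: "\<pi> \<in> tile_maps r s T T'" by blast
  have "\<pi> permutes {1..n}"
    using \<pi> unfolding tile_maps_def tilingsD(2)[OF T] tilingsD(2)[OF T'] by (auto intro: bij_imp_permutes)
  moreover have "links r T \<subseteq> forbidden_steps r s n \<pi>"
  proof
    fix i assume "i \<in> links r T"
    then obtain t where t: "t \<in> T" "i \<in> t" "i + r \<in> t" by (auto simp: links_def)
    then have "i \<in> {1..n}" "i + r \<in> {1..n}" using tilingsD(2)[OF T] by blast+
    moreover have "steps_by r s \<pi> t" using \<pi> t(1) by (auto simp: tile_maps_def)
    ultimately show "i \<in> forbidden_steps r s n \<pi>" using t by (auto simp: forbidden_steps_def steps_by_def)
  qed
  ultimately show "\<pi> \<in> {\<pi>. \<pi> permutes {1..n} \<and> links r T \<subseteq> forbidden_steps r s n \<pi>}" by simp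
qed

lemma finite_tilings: "finite (tilings r n)"
  by (rule finite_subset[OF _ finitely_many_partition_on[of "{1..n}"]]) (auto simp: tilings_def)

lemma card_block_in_range: "T \<in> tilings r n \<Longrightarrow> t \<in> T \<Longrightarrow> card t \<in> {1..n}"
proof -
  assume T: "T \<in> tilings r n" and t: "t \<in> T"
  have "t \<subseteq> {1..n}" using tilingsD(2)[OF T] t by blast
  moreover from this have "finite t" by (rule finite_subset) simp
  moreover have "t \<noteq> {}" using tilingsD(4)[OF T] t by auto
  ultimately show ?thesis using card_mono[of "{1..n}" t] by (auto simp: Suc_le_eq card_gt_0_iff)
qed

text \<open>Grouping tiles by size; with \<open>g i = i\<close> it says that the sizes form a partition of \<open>n\<close>, with \<open>g i = 1\<close>
that the multiplicities add up to the number of tiles.\<close>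

lemma sum_over_tiles:
  fixes g :: "nat \<Rightarrow> nat"
  assumes "T \<in> tilings r n"
  shows "(\<Sum>t\<in>T. g (card t)) = (\<Sum>i=1..n. size_count T i * g i)"
proof -
  have "(\<Sum>t\<in>T. g (card t)) = (\<Sum>i=1..n. \<Sum>t\<in>{t \<in> T. card t = i}. g (card t))"
    using card_block_in_range[OF assms] tilingsD(5)[OF assms] by (intro sum.group[symmetric]) auto
  then show ?thesis by (simp add: size_count_def)
qed

lemma size_count_in_int_partitions:
  assumes T: "T \<in> tilings r n"
  shows "size_count T \<in> int_partitions n"
proof -
  have "size_count T i = 0" if "i \<notin> {1..n}" for i
    using card_block_in_range[OF T] that by (auto simp: size_count_def card_eq_0_iff)
  moreover have "(\<Sum>i=1..n. i * size_count T i) = n"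
  proof -
    have "(\<Sum>i=1..n. i * size_count T i) = (\<Sum>t\<in>T. card t)"
      using sum_over_tiles[OF T, of "\<lambda>i. i"] by (simp add: mult.commute)
    also have "\<dots> = n"
      using product_partition[OF tilingsD(1)[OF T]] finite_tile tilingsD(6)[OF T] by force
    finally show ?thesis .
  qed
  ultimately show ?thesis by (simp add: int_partitions_def)
qed

lemma int_partitionsD:
  assumes "a \<in> int_partitions n"
  shows "i \<notin> {1..n} \<Longrightarrow> a i = 0" and "(\<Sum>i=1..n. i * a i) = n"
  using assms by (simp_all add: int_partitions_def)

text \<open>Both multiplicity functions vanish outside \<open>{1..n}\<close>, so agreement on \<open>{1..n}\<close> is equality of functions;
the sum over tilings can then be grouped by the value of \<open>size_count\<close>.\<close>

lemma tiling_coeff_eq: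
  assumes "a \<in> int_partitions n"
  shows "tiling_coeff n r a = card {T \<in> tilings r n. size_count T = a}"
proof -
  have "(\<forall>i\<in>{1..n}. card {t \<in> T. card t = i} = a i) \<longleftrightarrow> size_count T = a" if "T \<in> tilings r n" for T
  proof
    assume *: "\<forall>i\<in>{1..n}. card {t \<in> T. card t = i} = a i"
    have "size_count T i = a i" if i: "i \<notin> {1..n}" for i
      using int_partitionsD(1)[OF assms i]
        int_partitionsD(1)[OF size_count_in_int_partitions[OF \<open>T \<in> tilings r n\<close>] i] by simp
    moreover have "size_count T i = a i" if "i \<in> {1..n}" for i
      using * that by (simp add: size_count_def)
    ultimately show "size_count T = a" by (intro ext) blast
  qed (auto simp: size_count_def)
  then show ?thesis unfolding tiling_coeff_def by (intro arg_cong[of _ _ card]) auto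
qed

lemma card_perms_stepping_along_links:
  assumes r: "r \<ge> 1" and s: "s \<ge> 1" and T: "T \<in> tilings r n"
  shows "card {\<pi>. \<pi> permutes {1..n} \<and> links r T \<subseteq> forbidden_steps r s n \<pi>} =
    tiling_coeff n s (size_count T) * ((\<Prod>i=1..n. fact (size_count T i)) * 2 ^ (\<Sum>i=2..n. size_count T i))"
proof -
  define A where "A = {T' \<in> tilings s n. size_count T' = size_count T}"
  let ?O = "\<Prod>t\<in>T. orientations (card t)"
  have finA: "finite A" using finite_tilings by (simp add: A_def)
  have each: "card (tile_maps r s T T') = (\<Prod>i=1..n. fact (size_count T i)) * ?O" if "T' \<in> A" for T'
  proof -
    have T': "T' \<in> tilings s n" "size_count T = size_count T'" using that by (simp_all add: A_def)
    have "card ` T \<subseteq> {1..n}" using card_block_in_range[OF T] by blast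
    then show ?thesis
      by (rule card_tile_maps[OF r s tilingsD(5)[OF T] tilingsD(3)[OF T] tilingsD(6)[OF T]
        tilingsD(5)[OF T'(1)] tilingsD(3)[OF T'(1)] tilingsD(6)[OF T'(1)] T'(2) finite_atLeastAtMost])
  qed
  have fin: "finite (tile_maps r s T T')" if "T' \<in> A" for T'
    by (rule card_ge_0_finite) (auto simp: each[OF that] orientations_def tilingsD(5)[OF T] intro!: prod_pos)
  have "(`) f ` T = T'" if "T' \<in> A" "f \<in> tile_maps r s T T'" for f T'
    using that tilingsD[of T' s n] by (intro tile_maps_image_eq) (auto simp: A_def)
  then have dj: "\<forall>T1\<in>A. \<forall>T2\<in>A. T1 \<noteq> T2 \<longrightarrow> tile_maps r s T T1 \<inter> tile_maps r s T T2 = {}"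
    by blast
  have "?O = (\<Prod>i=1..n. \<Prod>t\<in>{t \<in> T. card t = i}. orientations (card t))"
    using card_block_in_range[OF T] tilingsD(5)[OF T] by (intro prod.group[symmetric]) auto
  also have "\<dots> = (\<Prod>i=1..n. orientations i ^ size_count T i)" by (simp add: size_count_def)
  \<comment> \<open>Singletons have one orientation and drop out.\<close>
  also have "\<dots> = (\<Prod>i=2..n. orientations i ^ size_count T i)"
    by (rule prod.mono_neutral_right) (auto simp: orientations_def)
  also have "\<dots> = (\<Prod>i=2..n. 2 ^ size_count T i)" by (intro prod.cong) (auto simp: orientations_def)
  also have "\<dots> = 2 ^ (\<Sum>i=2..n. size_count T i)" by (simp add: power_sum)
  finally have O: "?O = 2 ^ (\<Sum>i=2..n. size_count T i)" .
  have "card {\<pi>. \<pi> permutes {1..n} \<and> links r T \<subseteq> forbidden_steps r s n \<pi>} = (\<Sum>T'\<in>A. card (tile_maps r s T T'))"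
    unfolding perms_stepping_along_links[OF r T] A_def[symmetric]
    using finA fin dj by (intro card_UN_disjoint) auto
  also have "\<dots> = card A * ((\<Prod>i=1..n. fact (size_count T i)) * ?O)" using each by simp
  finally show ?thesis
    unfolding O A_def tiling_coeff_eq[OF size_count_in_int_partitions[OF T]] .
qed

section \<open>Inclusion-exclusion over tilings\<close>

text \<open>Expansion of the product of \<open>1 - 1\<close> over \<open>B\<close>.\<close>

lemma sum_alternating_Pow:
  assumes "finite B"
  shows "(\<Sum>E\<in>Pow B. (-1) ^ card E) = (if B = {} then 1 else 0 :: 'a :: comm_ring_1)"
  using prod_diff_conv_sum[OF assms, of "\<lambda>_. 1 :: 'a" "\<lambda>_. 1"] assms by (simp add: power_0_left)

lemma finite_int_partitions: "finite (int_partitions n)"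
proof (rule finite_subset)
  show "int_partitions n \<subseteq> {a. \<forall>i. (i \<in> {1..n} \<longrightarrow> a i \<in> {..n}) \<and> (i \<notin> {1..n} \<longrightarrow> a i = 0)}"
  proof (intro subsetI CollectI allI conjI impI)
    fix a i assume a: "a \<in> int_partitions n"
    show "i \<notin> {1..n} \<Longrightarrow> a i = 0" by (rule int_partitionsD(1)[OF a])
    assume i: "i \<in> {1..n}"
    \<comment> \<open>A part of size at least 1 occurs at most \<open>n\<close> times, which bounds the values of \<open>a\<close>.\<close>
    have "1 * a i \<le> i * a i" using i by (intro mult_le_mono1) simp
    also have "i * a i \<le> (\<Sum>i=1..n. i * a i)" using i by (intro member_le_sum) auto
    also have "\<dots> = n" by (rule int_partitionsD(2)[OF a])
    finally show "a i \<in> {..n}" by simp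
  qed
qed (rule finite_set_of_finite_funs; simp)

theorem mainTheorem2:
  fixes r s n :: nat
  assumes "r \<ge> 1" and "s \<ge> 1" and "n \<ge> 1"
  shows "real (num_perms_avoiding r s n) =
    (\<Sum>a\<in>int_partitions n.
       real (tiling_coeff n s a) * real (tiling_coeff n r a)
       * (-1) powi (int (\<Sum>i=1..n. a i) - int n)
       * (\<Prod>i=1..n. fact (a i))
       * 2 ^ (\<Sum>i=2..n. a i))"
proof -
  let ?F = "forbidden_steps r s n"
  let ?S = "{\<pi>. \<pi> permutes {1..n}}"
  let ?L = "{i. 1 \<le> i \<and> i + r \<le> n}"
  define W :: "(nat \<Rightarrow> nat) \<Rightarrow> nat" where "W a = (\<Prod>i=1..n. fact (a i)) * 2 ^ (\<Sum>i=2..n. a i)" for a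
  have finS: "finite ?S" by (simp add: finite_permutations)
  have finL: "finite ?L" by (rule finite_subset[of _ "{..n}"]) auto
  have F: "?F \<pi> \<subseteq> ?L" for \<pi> by (auto simp: forbidden_steps_def)
  have finF: "finite (?F \<pi>)" for \<pi> using finite_subset[OF F finL] .
  have "real (num_perms_avoiding r s n) = real (card {\<pi> \<in> ?S. ?F \<pi> = {}})"
    unfolding num_perms_avoiding_def forbidden_steps_def
    by (intro arg_cong[of _ _ "\<lambda>A. real (card A)"]) auto
  also have "\<dots> = (\<Sum>\<pi>\<in>?S. if ?F \<pi> = {} then 1 else 0)"
    using finS by (simp add: sum.If_cases Int_def)
  \<comment> \<open>Inclusion-exclusion: the alternating sum over sets of forbidden steps detects their absence.\<close>
  also have "\<dots> = (\<Sum>\<pi>\<in>?S. \<Sum>E\<in>Pow (?F \<pi>). (-1) ^ card E)"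
    by (intro sum.cong refl sum_alternating_Pow[symmetric] finF)
  also have "\<dots> = (\<Sum>\<pi>\<in>?S. \<Sum>E\<in>{E \<in> Pow ?L. E \<subseteq> ?F \<pi>}. (-1) ^ card E)"
    using F by (intro sum.cong refl) blast
  also have "\<dots> = (\<Sum>E\<in>Pow ?L. \<Sum>\<pi>\<in>{\<pi> \<in> ?S. E \<subseteq> ?F \<pi>}. (-1) ^ card E)"
    using finS finL by (intro sum.swap_restrict) auto
  also have "\<dots> = (\<Sum>E\<in>Pow ?L. (-1) ^ card E * real (card {\<pi>. \<pi> permutes {1..n} \<and> E \<subseteq> ?F \<pi>}))"
    by (simp add: mult.commute)
  \<comment> \<open>Every set of link positions is the link set of exactly one tiling.\<close>
  also have "\<dots> = (\<Sum>T\<in>tilings r n. (-1) ^ card (links r T) *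
      real (card {\<pi>. \<pi> permutes {1..n} \<and> links r T \<subseteq> ?F \<pi>}))"
    using sum.reindex_bij_betw[OF bij_betw_links[OF assms(1), of n],
      of "\<lambda>E. (-1) ^ card E * real (card {\<pi>. \<pi> permutes {1..n} \<and> E \<subseteq> ?F \<pi>})"] by simp
  also have "\<dots> = (\<Sum>T\<in>tilings r n. (-1) powi (int (\<Sum>i=1..n. size_count T i) - int n) *
      (real (tiling_coeff n s (size_count T)) * real (W (size_count T))))"
  proof (intro sum.cong refl)
    fix T assume T: "T \<in> tilings r n"
    have "(\<Sum>i=1..n. size_count T i) = card T" using sum_over_tiles[OF T, of "\<lambda>_. 1"] by simp
    then have "int (\<Sum>i=1..n. size_count T i) - int n = - int (card (links r T))"
      using card_links[OF assms(1) T] by linarith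
    then have sgn: "(-1) powi (int (\<Sum>i=1..n. size_count T i) - int n) = ((-1) ^ card (links r T) :: real)"
      by (simp add: power_int_minus flip: power_inverse)
    show "(-1) ^ card (links r T) * real (card {\<pi>. \<pi> permutes {1..n} \<and> links r T \<subseteq> ?F \<pi>}) =
      (-1) powi (int (\<Sum>i=1..n. size_count T i) - int n) *
      (real (tiling_coeff n s (size_count T)) * real (W (size_count T)))"
      unfolding sgn card_perms_stepping_along_links[OF assms(1,2) T] W_def by simp
  qed
  also have "\<dots> = (\<Sum>a\<in>int_partitions n. \<Sum>T\<in>{T \<in> tilings r n. size_count T = a}.
      (-1) powi (int (\<Sum>i=1..n. size_count T i) - int n) *
      (real (tiling_coeff n s (size_count T)) * real (W (size_count T))))"
    using size_count_in_int_partitions finite_tilings finite_int_partitions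
    by (intro sum.group[symmetric]) auto
  also have "\<dots> = (\<Sum>a\<in>int_partitions n. real (tiling_coeff n r a) *
      ((-1) powi (int (\<Sum>i=1..n. a i) - int n) * (real (tiling_coeff n s a) * real (W a))))"
    by (intro sum.cong refl) (simp add: tiling_coeff_eq)
  also have "\<dots> = (\<Sum>a\<in>int_partitions n.
       real (tiling_coeff n s a) * real (tiling_coeff n r a)
       * (-1) powi (int (\<Sum>i=1..n. a i) - int n)
       * (\<Prod>i=1..n. fact (a i))
       * 2 ^ (\<Sum>i=2..n. a i))"
    by (intro sum.cong refl) (simp add: W_def)
  finally show ?thesis .
qed

end
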